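(* Let $a,b\in\mathbb{Q}$ with $a\neq0$, and for positive integers $n$ let $f_n(x)=\frac1a\left((ax+b)^n-b\right)$. If $b\notin\{0,\pm1\}$, then $f_m(x)$ is not a divisor of $f_n(x)$ in $\mathbb{Q}[x]$ for any positive integers $m<n$. If $b\in\{0,\pm1\}$, then for positive integers $m,n$, $f_m(x)$ is a divisor of $f_n(x)$ in $\mathbb{Q}[x]$ if and only if: (1) in case $b=0$: $m\le n$; (2) in case $b=1$: $m\mid n$; (3) in case $b=-1$: $m\mid n$ and $\gcd(n/m,2)=1$. *)

theory Defs
  imports "HOL-Computational_Algebra.Polynomial"
begin

definition f_poly :: "rat \<Rightarrow> rat \<Rightarrow> nat \<Rightarrow> rat poly" where
  "f_poly a b n = smult (1 / a) ([:b, a:] ^ n - [:b:])"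

end

theory Submission
  imports Defs
begin

text \<open>Put \<open>p = a x + b\<close> and \<open>n = q m + r\<close> with \<open>r < m\<close>. Modulo \<open>p^m - b\<close>, the
  polynomial \<open>p^n - b\<close> reduces to \<open>b^q p^r - b\<close>, whose degree is less than \<open>m\<close>, so
  divisibility means that this remainder vanishes. For \<open>b \<noteq> 0\<close> this says \<open>r = 0\<close> and
  \<open>b^q = b\<close>, and a rational number other than 0 and \<open>\<plusminus>1\<close> has infinite order.\<close>

lemma f_poly_dvd_iff:
  assumes "a \<noteq> 0"
  shows "f_poly a b m dvd f_poly a b n \<longleftrightarrow> [:b, a:] ^ m - [:b:] dvd [:b, a:] ^ n - [:b:]"
  using assms by (simp add: f_poly_def smult_dvd_iff dvd_smult_iff)

lemma linear_power_diff_dvd_iff: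
  fixes a b :: "'a::field"
  assumes a: "a \<noteq> 0" and m: "0 < m"
  shows "[:b, a:] ^ m - [:b:] dvd [:b, a:] ^ n - [:b:] \<longleftrightarrow>
    smult (b ^ (n div m)) ([:b, a:] ^ (n mod m)) = [:b:]"
proof -
  define p where "p = [:b, a:]"
  define q r where "q = n div m" and "r = n mod m"
  have deg: "degree (p ^ k) = k" for k
    using a by (simp add: p_def degree_power_eq)
  have "p ^ n = (p ^ m) ^ q * p ^ r"
    by (simp add: q_def r_def flip: power_mult power_add)
  then have split: "p ^ n - [:b:] =
      ((p ^ m) ^ q - [:b:] ^ q) * p ^ r + (smult (b ^ q) (p ^ r) - [:b:])"
    by (simp add: algebra_simps poly_const_pow)
  \<comment> \<open>\<open>X - Y\<close> divides \<open>X ^ q - Y ^ q\<close>, here with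
    \<open>X = p ^ m\<close> and \<open>Y = [:b:]\<close>; only the second summand of
    \<open>split\<close> is left to test.\<close>
  have "p ^ m - [:b:] dvd (p ^ m) ^ q - [:b:] ^ q"
    by (simp add: power_diff_sumr2)
  then have "p ^ m - [:b:] dvd p ^ n - [:b:] \<longleftrightarrow>
      p ^ m - [:b:] dvd smult (b ^ q) (p ^ r) - [:b:]"
    unfolding split by (intro dvd_add_right_iff dvd_mult2)
  also have "\<dots> \<longleftrightarrow> smult (b ^ q) (p ^ r) - [:b:] = 0"
  proof -
    \<comment> \<open>Since \<open>0 < m\<close>, subtracting a constant keeps the degree
      \<open>m\<close>, so a nonzero multiple cannot have degree below \<open>m\<close>.\<close>
    have "degree (p ^ m - [:b:]) = m"
      unfolding diff_conv_add_uminus using m by (subst degree_add_eq_left) (simp_all add: deg)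
    moreover have "degree (smult (b ^ q) (p ^ r) - [:b:]) < m"
      using m by (intro degree_diff_less) (simp_all add: deg r_def)
    ultimately show ?thesis
      using dvd_imp_degree_le[of "p ^ m - [:b:]" "smult (b ^ q) (p ^ r) - [:b:]"] by auto
  qed
  finally show ?thesis
    by (simp add: p_def q_def r_def)
qed

text \<open>Compare degrees: as \<open>c\<close> is nonzero, the left side has degree
  \<open>r\<close>. With \<open>c = b ^ (n div m)\<close> this covers every nonzero
  \<open>b\<close>.\<close>

lemma smult_linear_power_eq_const_iff:
  fixes a b c :: "'a::field"
  assumes "a \<noteq> 0" and "c \<noteq> 0"
  shows "smult c ([:b, a:] ^ r) = [:d:] \<longleftrightarrow> r = 0 \<and> c = d"
proof (cases "r = 0")
  case False
  moreover have "degree (smult c ([:b, a:] ^ r)) = r"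
    using assms by (simp add: degree_power_eq)
  ultimately show ?thesis
    by (metis degree_pCons_0)
qed simp

lemma f_poly_dvd_iff_nonzero:
  assumes "a \<noteq> 0" and "0 < m" and "b \<noteq> 0"
  shows "f_poly a b m dvd f_poly a b n \<longleftrightarrow> m dvd n \<and> b ^ (n div m) = b"
  using assms
  by (simp add: f_poly_dvd_iff linear_power_diff_dvd_iff smult_linear_power_eq_const_iff
      mod_eq_0_iff_dvd)

lemma power_eq_self_imp_abs_eq_1:
  fixes b :: "'a::linordered_field"
  assumes "b ^ k = b" and "1 < k" and "b \<noteq> 0"
  shows "\<bar>b\<bar> = 1"
proof -
  have "b * b ^ (k - 1) = b * 1"
    using assms by (simp flip: power_Suc)
  \<comment> \<open>Absolute values make the base nonnegative, where a positive power is
    injective.\<close>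
  then have "\<bar>b\<bar> ^ (k - 1) = 1"
    using assms(3) by (simp flip: power_abs)
  then show ?thesis
    using assms(2) power_eq_iff_eq_base[of "k - 1" "\<bar>b\<bar>" 1] by simp
qed

theorem corollary3p3:
  fixes a b :: rat
  assumes "a \<noteq> 0"
  shows "(b \<notin> {0, 1, -1} \<longrightarrow>
            (\<forall>m n :: nat. 0 < m \<longrightarrow> m < n \<longrightarrow> \<not> f_poly a b m dvd f_poly a b n)) \<and>
         (b = 0 \<longrightarrow>
            (\<forall>m n :: nat. 0 < m \<longrightarrow> 0 < n \<longrightarrow>
              (f_poly a b m dvd f_poly a b n \<longleftrightarrow> m \<le> n))) \<and>
         (b = 1 \<longrightarrow>
            (\<forall>m n :: nat. 0 < m \<longrightarrow> 0 < n \<longrightarrow>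
              (f_poly a b m dvd f_poly a b n \<longleftrightarrow> m dvd n))) \<and>
         (b = -1 \<longrightarrow>
            (\<forall>m n :: nat. 0 < m \<longrightarrow> 0 < n \<longrightarrow>
              (f_poly a b m dvd f_poly a b n \<longleftrightarrow> m dvd n \<and> gcd (n div m) 2 = 1)))"
proof (intro conjI impI allI)
  fix m n :: nat
  assume b: "b \<notin> {0, 1, -1}" and m: "0 < m" and mn: "m < n"
  show "\<not> f_poly a b m dvd f_poly a b n"
  proof
    assume "f_poly a b m dvd f_poly a b n"
    then have "m dvd n" and pow: "b ^ (n div m) = b"
      using assms m b by (simp_all add: f_poly_dvd_iff_nonzero)
    \<comment> \<open>\<open>m < n\<close> excludes the quotient 1, for which \<open>pow\<close>
      would hold trivially.\<close>
    then have "1 < n div m"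
      using m mn by (auto elim!: dvdE)
    then have "\<bar>b\<bar> = 1"
      using pow b by (intro power_eq_self_imp_abs_eq_1) auto
    then show False
      using b by (auto simp: abs_if split: if_splits)
  qed
next
  fix m n :: nat
  assume b: "b = 0" and m: "0 < m"
  \<comment> \<open>The remainder is \<open>0 ^ (n div m)\<close> times a nonzero polynomial; as
    \<open>0 ^ 0 = 1\<close>, it vanishes exactly for a positive quotient.\<close>
  have "f_poly a b m dvd f_poly a b n \<longleftrightarrow> 0 < n div m"
    unfolding f_poly_dvd_iff[OF assms] linear_power_diff_dvd_iff[OF assms m]
    using assms b by (simp add: power_0_left)
  then show "f_poly a b m dvd f_poly a b n \<longleftrightarrow> m \<le> n"
    using m by (simp add: div_greater_zero_iff)
next
  fix m n :: nat
  assume "b = 1" and "0 < m"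
  then show "f_poly a b m dvd f_poly a b n \<longleftrightarrow> m dvd n"
    using assms by (simp add: f_poly_dvd_iff_nonzero)
next
  fix m n :: nat
  assume "b = -1" and "0 < m"
  then show "f_poly a b m dvd f_poly a b n \<longleftrightarrow> m dvd n \<and> gcd (n div m) 2 = 1"
    \<comment> \<open>A power of -1 equals -1 exactly when the exponent is odd, that is, coprime to
      2.\<close>
    using assms by (simp add: f_poly_dvd_iff_nonzero minus_one_power_iff coprime_right_2_iff_odd
        flip: coprime_iff_gcd_eq_1)
qed

end
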